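(* Let $\alpha>-1$ and $n\ge 0$. Let $x_0,x_1,\dots,x_n$ be the roots of the Laguerre polynomial $L_{n+1}^{(\alpha)}$, listed in monotonic order, and let $w_0,\dots,w_n$ be the weights of the corresponding $(n+1)$-point Gauss-Laguerre quadrature rule with respect to the weight function $x^\alpha e^{-x}$ on $[0,\infty)$. Then the barycentric weights for the nodes $x_0,\dots,x_n$ are $$\lambda_j=C^{(\alpha)}(-1)^j\sqrt{x_jw_j},\qquad j=0,\dots,n,$$ where $C^{(\alpha)}=1$ for the simplified barycentric weights, and otherwise (that is, for the full barycentric weights $\lambda_j=\prod_{k\neq j}(x_j-x_k)^{-1}$) $$C^{(\alpha)}=\sigma\,\frac{1}{\sqrt{\Gamma(n+\alpha+2)\,(n+1)!}},$$ with $\sigma=+1$ for even $n$ and $\sigma=-1$ for odd $n$.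
   Context: $L_{m}^{(\alpha)}$ is the Laguerre polynomial of degree $m$, orthogonal with respect to $x^\alpha e^{-x}$ on $[0,\infty)$, with leading coefficient $(-1)^m/m!$. The Gaussian quadrature rule $\int_0^\infty x^\alpha e^{-x}f(x)\,dx\simeq\sum_{j=0}^nw_jf(x_j)$ is exact for all polynomials of degree at most $2n+1$. The full barycentric weights of distinct nodes $x_0,\dots,x_n$ are $\lambda_j=\prod_{k\neq j}(x_j-x_k)^{-1}$. Simplified barycentric weights are those obtained from the full ones by cancelling common factors independent of $j$, which leaves unchanged the interpolant $p_n(x)=\Big(\sum_{j=0}^n\frac{\lambda_j}{x-x_j}f(x_j)\Big)\Big/\Big(\sum_{j=0}^n\frac{\lambda_j}{x-x_j}\Big)$.
   Formalization: The formula with the constant σ/√(Γ(n+α+2)(n+1)!) for the full barycentric weights is asserted only for nodes in increasing order, since for decreasing order and odd n the sign σ = −1 is wrong; the simplified weights are covered for both orders. *)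

theory Defs
  imports "HOL-Analysis.Analysis" "HOL-Computational_Algebra.Polynomial"
begin

text \<open>
  \<open>I\<close> is the value of the integral of \<open>x\<^sup>\<alpha> e\<^sup>-\<^sup>x p(x)\<close> over \<open>[0, \<infinity>)\<close>. The relational form
  also asserts that the integral exists. The value of the integrand at \<open>0\<close>, where \<open>0 powr \<alpha> = 0\<close>,
  is irrelevant.
\<close>
definition laguerre_integral :: "real \<Rightarrow> real poly \<Rightarrow> real \<Rightarrow> bool" where
  "laguerre_integral \<alpha> p I \<longleftrightarrow>
     ((\<lambda>t. t powr \<alpha> * exp (- t) * poly p t) has_integral I) {0..}"

text \<open>\<open>L m\<close> is the Laguerre polynomial of degree \<open>m\<close> with parameter \<open>\<alpha>\<close>, for every \<open>m\<close>.\<close>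
definition laguerre_polys :: "real \<Rightarrow> (nat \<Rightarrow> real poly) \<Rightarrow> bool" where
  "laguerre_polys \<alpha> L \<longleftrightarrow>
     (\<forall>m. degree (L m) = m \<and> lead_coeff (L m) = (- 1) ^ m / fact m) \<and>
     (\<forall>m k. m \<noteq> k \<longrightarrow> laguerre_integral \<alpha> (L m * L k) 0)"

definition gauss_laguerre_weights ::
    "real \<Rightarrow> nat \<Rightarrow> (nat \<Rightarrow> real) \<Rightarrow> (nat \<Rightarrow> real) \<Rightarrow> bool" where
  "gauss_laguerre_weights \<alpha> n x w \<longleftrightarrow>
     (\<forall>p. degree p \<le> 2 * n + 1 \<longrightarrow>
        laguerre_integral \<alpha> p (\<Sum>j\<le>n. w j * poly p (x j)))"

definition full_bary_weight :: "nat \<Rightarrow> (nat \<Rightarrow> real) \<Rightarrow> nat \<Rightarrow> real" where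
  "full_bary_weight n x j = (\<Prod>k\<in>{..n} - {j}. inverse (x j - x k))"

text \<open>
  Simplified weights arise from the full ones by cancelling a factor \<open>c\<close> that is common to all \<open>j\<close>;
  the factor may be negative.
\<close>
definition simplified_bary_weights :: "nat \<Rightarrow> (nat \<Rightarrow> real) \<Rightarrow> (nat \<Rightarrow> real) \<Rightarrow> bool" where
  "simplified_bary_weights n x \<mu> \<longleftrightarrow>
     (\<exists>c. c \<noteq> 0 \<and> (\<forall>j\<le>n. full_bary_weight n x j = c * \<mu> j))"

definition bary_interpolant ::
    "nat \<Rightarrow> (nat \<Rightarrow> real) \<Rightarrow> (nat \<Rightarrow> real) \<Rightarrow> (real \<Rightarrow> real) \<Rightarrow> real \<Rightarrow> real" where
  "bary_interpolant n x \<mu> f t =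
     (\<Sum>j\<le>n. \<mu> j / (t - x j) * f (x j)) / (\<Sum>j\<le>n. \<mu> j / (t - x j))"

lemma bary_interpolant_simplified:
  assumes "simplified_bary_weights n x \<mu>"
  shows "bary_interpolant n x \<mu> f t = bary_interpolant n x (full_bary_weight n x) f t"
proof -
  obtain c where c: "c \<noteq> 0" "\<And>j. j \<le> n \<Longrightarrow> full_bary_weight n x j = c * \<mu> j"
    using assms unfolding simplified_bary_weights_def by blast
  have "(\<Sum>j\<le>n. full_bary_weight n x j / (t - x j) * f (x j))
          = c * (\<Sum>j\<le>n. \<mu> j / (t - x j) * f (x j))"
    unfolding sum_distrib_left by (intro sum.cong) (auto simp: c)
  moreover have "(\<Sum>j\<le>n. full_bary_weight n x j / (t - x j)) = c * (\<Sum>j\<le>n. \<mu> j / (t - x j))"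
    unfolding sum_distrib_left by (intro sum.cong) (auto simp: c)
  ultimately show ?thesis
    using c(1) unfolding bary_interpolant_def by simp
qed

end

theory Submission
  imports Defs
begin

text \<open>
  Write \<open>\<Lambda>\<^sub>\<alpha>\<close> for integration against \<open>x\<^sup>\<alpha> e\<^sup>-\<^sup>x\<close>, let \<open>P\<close> be the monic polynomial of degree
  \<open>N = n + 1\<close> whose roots are the nodes, and put \<open>q = P / (x - x\<^sub>j)\<close>, so that
  \<open>\<lambda>\<^sub>j = 1 / q(x\<^sub>j)\<close>. Since \<open>q\<close> vanishes at the other nodes and \<open>x q\<^sup>2\<close> has degree \<open>2n + 1\<close>,
  the quadrature rule gives \<open>\<Lambda>\<^sub>\<alpha>(x q\<^sup>2) = w\<^sub>j x\<^sub>j q(x\<^sub>j)\<^sup>2\<close>. Integrating the derivative of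
  \<open>x\<^sup>\<alpha>\<^sup>+\<^sup>1 e\<^sup>-\<^sup>x P q\<close>, where \<open>(P q)' = q\<^sup>2 + 2 P q'\<close>, and using orthogonality, one
  gets \<open>\<Lambda>\<^sub>\<alpha>(x q\<^sup>2) = \<Lambda>\<^sub>\<alpha>(P x q)\<close>, which by the Rodrigues formula is \<open>N! \<Gamma>(\<alpha> + N + 1)\<close>.
  Hence \<open>\<lambda>\<^sub>j\<^sup>2\<close> is known, and the sign of \<open>\<lambda>\<^sub>j\<close> follows from the order of the nodes.
\<close>

section \<open>Integration of polynomials against the Laguerre weight\<close>

definition laguerre_functional :: "real \<Rightarrow> real poly \<Rightarrow> real" where
  "laguerre_functional a p = integral {0..} (\<lambda>t. t powr a * exp (- t) * poly p t)"

lemma laguerre_integral_unique: "laguerre_integral a p I \<Longrightarrow> laguerre_functional a p = I"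
  unfolding laguerre_integral_def laguerre_functional_def by (rule integral_unique)

text \<open>A factor \<open>t\<close> raises the parameter from \<open>a\<close> to
  \<open>a + 1\<close>, and the constant term contributes a Gamma integral. This recursion allows
  induction on \<open>p\<close> with \<open>a\<close> arbitrary.\<close>

lemma laguerre_integral_pCons:
  assumes "a > -1" and "laguerre_integral (a + 1) p I"
  shows "laguerre_integral a (pCons c p) (c * Gamma (a + 1) + I)"
proof -
  have "((\<lambda>t. t powr (a + 1 - 1) / exp t) has_integral Gamma (a + 1)) {0..}"
    using assms(1) by (intro Gamma_integral_real) simp
  then have "((\<lambda>t. t powr (a + 1 - 1) / exp t * c) has_integral Gamma (a + 1) * c) {0..}"
    by (rule has_integral_mult_left)
  moreover have "((\<lambda>t. t powr (a + 1) * exp (- t) * poly p t) has_integral I) {0..}"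
    using assms(2) unfolding laguerre_integral_def .
  ultimately have "((\<lambda>t. t powr (a + 1 - 1) / exp t * c + t powr (a + 1) * exp (- t) * poly p t)
      has_integral Gamma (a + 1) * c + I) {0..}"
    by (rule has_integral_add)
  then have "((\<lambda>t. t powr a * exp (- t) * poly (pCons c p) t)
      has_integral Gamma (a + 1) * c + I) {0..}"
    \<comment> \<open>The integrands also agree at \<open>t = 0\<close>, since
      \<open>0 powr b = 0\<close> for every \<open>b\<close>.\<close>
    by (rule has_integral_eq[rotated]) (auto simp: exp_minus field_simps powr_add)
  then show ?thesis
    unfolding laguerre_integral_def by (simp add: mult.commute)
qed

lemma laguerre_integral_functional:
  "a > -1 \<Longrightarrow> laguerre_integral a p (laguerre_functional a p)"
proof (induction p arbitrary: a)
  case 0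
  then show ?case
    by (simp add: laguerre_integral_def laguerre_functional_def)
next
  case (pCons c p)
  then have "laguerre_integral (a + 1) p (laguerre_functional (a + 1) p)"
    by simp
  then show ?case
    using laguerre_integral_pCons[OF \<open>a > -1\<close>] laguerre_integral_unique by metis
qed

lemma laguerre_functional_pCons:
  "a > -1 \<Longrightarrow>
    laguerre_functional a (pCons c p) = c * Gamma (a + 1) + laguerre_functional (a + 1) p"
  by (intro laguerre_integral_unique laguerre_integral_pCons laguerre_integral_functional) auto

lemma laguerre_functional_0 [simp]: "laguerre_functional a 0 = 0"
  by (simp add: laguerre_functional_def)

lemma laguerre_functional_add:
  assumes "a > -1"
  shows "laguerre_functional a (p + q) = laguerre_functional a p + laguerre_functional a q"
proof -
  have "laguerre_integral a (p + q) (laguerre_functional a p + laguerre_functional a q)"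
    using has_integral_add[OF laguerre_integral_functional[OF assms, unfolded laguerre_integral_def]
        laguerre_integral_functional[OF assms, unfolded laguerre_integral_def], of p q]
    by (simp add: laguerre_integral_def distrib_left)
  then show ?thesis
    by (rule laguerre_integral_unique)
qed

lemma laguerre_functional_smult:
  "laguerre_functional a (smult c p) = c * laguerre_functional a p"
proof -
  have "(\<lambda>t. t powr a * exp (- t) * poly (smult c p) t) =
      (\<lambda>t. c * (t powr a * exp (- t) * poly p t))"
    by (simp add: fun_eq_iff)
  then show ?thesis
    unfolding laguerre_functional_def by simp
qed

lemma laguerre_functional_diff:
  assumes "a > -1"
  shows "laguerre_functional a (p - q) = laguerre_functional a p - laguerre_functional a q"
  using laguerre_functional_add[OF assms, of "p - q" q] by simp

text \<open>This integrates the derivative of \<open>t^(a+1) e^(-t) p(t)\<close>, whose boundary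
  terms vanish. The induction replaces limits by the functional equation of Gamma.\<close>

lemma laguerre_functional_by_parts:
  "a > -1 \<Longrightarrow> laguerre_functional a ([:0, 1:] * pderiv p + [:a + 1, -1:] * p) = 0"
proof (induction p arbitrary: a)
  case 0
  then show ?case by simp
next
  case (pCons c p)
  have G: "Gamma (a + 2) = (a + 1) * Gamma (a + 1)"
    using Gamma_plus1[of "a + 1"] pCons.prems
    by (auto simp: nonpos_Ints_def add.commute add.left_commute)
  have "[:0, 1:] * pderiv (pCons c p) + [:a + 1, -1:] * pCons c p =
      [:c * (a + 1), - c:] + pCons 0 ([:0, 1:] * pderiv p + [:(a + 1) + 1, -1:] * p)"
    by (rule poly_eq_poly_eq_iff[THEN iffD1]) (simp add: fun_eq_iff pderiv_pCons algebra_simps)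
  moreover have "laguerre_functional a [:c * (a + 1), - c:] = 0"
    using pCons.prems by (simp add: laguerre_functional_pCons add.assoc G)
  moreover have "laguerre_functional (a + 1) ([:0, 1:] * pderiv p + [:(a + 1) + 1, -1:] * p) = 0"
    by (rule pCons.IH) (use pCons.prems in simp)
  ultimately show ?case
    using pCons.prems
    by (simp only: laguerre_functional_add laguerre_functional_pCons)
qed

section \<open>Rodrigues formula and orthogonality\<close>

text \<open>The witness is \<open>E = (-1)^N x^(-a) e^x (d/dx)^N (x^(a+N) e^(-x))\<close>;
  integrating by parts \<open>N\<close> times moves the derivatives onto \<open>p\<close>.\<close>

lemma rodrigues_laguerre_functional:
  "a > -1 \<Longrightarrow> \<exists>E. degree E \<le> N \<and> coeff E N = 1 \<and>
    (\<forall>p. laguerre_functional a (E * p) = laguerre_functional (a + real N) ((pderiv ^^ N) p))"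
proof (induction N arbitrary: a)
  case 0
  then show ?case
    by (intro exI[of _ 1]) simp
next
  case (Suc N)
  have "a + 1 > -1"
    using Suc.prems by simp
  from Suc.IH[OF this] obtain E where E: "degree E \<le> N" "coeff E N = 1"
    "\<And>p. laguerre_functional (a + 1) (E * p) =
        laguerre_functional (a + 1 + real N) ((pderiv ^^ N) p)"
    by blast
  \<comment> \<open>\<open>F\<close> is \<open>- x^(-a) e^x\<close> times the derivative of
    \<open>x^(a+1) e^(-x) E\<close>.\<close>
  define F where "F = [:- (a + 1), 1:] * E - [:0, 1:] * pderiv E"
  have E0: "coeff E i = 0" if "i > N" for i
    using E(1) that by (simp add: coeff_eq_0)
  have "degree F \<le> Suc N"
    by (rule degree_le) (auto simp: F_def E0 coeff_pCons coeff_pderiv split: nat.splits)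
  moreover have "coeff F (Suc N) = 1"
    by (simp add: F_def E0 E(2) coeff_pderiv)
  moreover have "laguerre_functional a (F * p) =
      laguerre_functional (a + real (Suc N)) ((pderiv ^^ Suc N) p)" for p
  proof -
    have eq: "F * p = pCons 0 (E * pderiv p) -
        ([:0, 1:] * pderiv (E * p) + [:a + 1, -1:] * (E * p))"
      by (rule poly_eq_poly_eq_iff[THEN iffD1])
        (simp add: fun_eq_iff F_def pderiv_mult algebra_simps)
    have "laguerre_functional a (F * p) = laguerre_functional (a + 1) (E * pderiv p)"
      unfolding eq laguerre_functional_diff[OF Suc.prems]
        laguerre_functional_by_parts[OF Suc.prems]
      using Suc.prems by (simp add: laguerre_functional_pCons)
    then show ?thesis
      by (simp add: E(3) funpow_Suc_right del: funpow.simps) (simp add: add_ac)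
  qed
  ultimately show ?case
    by blast
qed

text \<open>By \<open>orth\<close>, \<open>Q\<close> may be replaced by the Rodrigues polynomial
  \<open>E\<close>, as \<open>Q - E\<close> has degree below \<open>N\<close>; the
  \<open>N\<close>-th derivative of the monic \<open>P\<close> is the constant \<open>N!\<close>.
  Expressing the degree bound through coefficients leaves only \<open>r = 0\<close> when
  \<open>N = 0\<close>.\<close>

lemma laguerre_functional_monic_orthogonal:
  assumes a: "a > -1"
    and P: "degree P \<le> N" "coeff P N = 1"
    and Q: "degree Q \<le> N" "coeff Q N = 1"
    and orth: "\<And>r. (\<And>i. i \<ge> N \<Longrightarrow> coeff r i = 0) \<Longrightarrow> laguerre_functional a (P * r) = 0"
  shows "laguerre_functional a (P * Q) = fact N * Gamma (a + real N + 1)"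
proof -
  obtain E where E: "degree E \<le> N" "coeff E N = 1"
    "\<And>p. laguerre_functional a (E * p) = laguerre_functional (a + real N) ((pderiv ^^ N) p)"
    using rodrigues_laguerre_functional[OF a] by blast
  have "coeff (Q - E) i = 0" if "i \<ge> N" for i
    using that P Q E by (cases "i = N") (auto simp: coeff_eq_0)
  then have "laguerre_functional a (P * (Q - E)) = 0"
    by (rule orth)
  then have "laguerre_functional a (P * Q) = laguerre_functional a (E * P)"
    by (simp add: right_diff_distrib laguerre_functional_diff[OF a] mult.commute)
  also have "(pderiv ^^ N) P = [:fact N:]"
    using P by (intro poly_eqI)
      (auto simp: coeff_higher_pderiv coeff_pCons coeff_eq_0 pochhammer_fact split: nat.splits)
  then have "laguerre_functional a (E * P) = fact N * Gamma (a + real N + 1)"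
    using a by (simp add: E(3) laguerre_functional_pCons)
  finally show ?thesis .
qed

text \<open>Subtracting a multiple of \<open>L k\<close> removes the top coefficient of
  \<open>p\<close>, and \<open>L k\<close> itself is orthogonal to \<open>L m\<close> because
  \<open>k < m\<close>.\<close>

lemma laguerre_polys_orthogonal:
  assumes a: "a > -1" and L: "laguerre_polys a L"
  shows "k \<le> m \<Longrightarrow> (\<And>i. i \<ge> k \<Longrightarrow> coeff p i = 0) \<Longrightarrow> laguerre_functional a (L m * p) = 0"
proof (induction k arbitrary: p)
  case 0
  then have "p = 0"
    by (intro poly_eqI) simp
  then show ?case by simp
next
  case (Suc k)
  have deg: "degree (L k) = k" and lead: "coeff (L k) k \<noteq> 0"
    using L unfolding laguerre_polys_def by (metis, metis divide_eq_0_iff fact_nonzero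
        power_eq_0_iff zero_neq_neg_one)
  define c where "c = coeff p k / coeff (L k) k"
  have "coeff (p - smult c (L k)) i = 0" if "i \<ge> k" for i
    using that deg lead Suc.prems(2)[of i] by (cases "i = k") (auto simp: c_def coeff_eq_0)
  then have "laguerre_functional a (L m * (p - smult c (L k))) = 0"
    using Suc.IH Suc.prems(1) by simp
  moreover have "laguerre_functional a (L m * L k) = 0"
    using L Suc.prems(1) unfolding laguerre_polys_def by (intro laguerre_integral_unique) auto
  ultimately show ?case
    by (simp add: right_diff_distrib laguerre_functional_diff[OF a] laguerre_functional_smult)
qed

section \<open>Signs of the barycentric weights\<close>

lemma sgn_prod:
  fixes f :: "'a \<Rightarrow> 'b::linordered_idom"
  shows "sgn (prod f A) = (\<Prod>k\<in>A. sgn (f k))"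
  by (induction A rule: infinite_finite_induct) (simp_all add: sgn_mult)

text \<open>Exactly the \<open>n - j\<close> factors with \<open>k > j\<close> are negative.\<close>

lemma sgn_prod_diff_strict_mono:
  fixes x :: "nat \<Rightarrow> real"
  assumes "strict_mono_on {..n} x" "j \<le> n"
  shows "sgn (\<Prod>k\<in>{..n} - {j}. x j - x k) = (- 1) ^ (n - j)"
proof -
  have "sgn (\<Prod>k\<in>{..n} - {j}. x j - x k) = (\<Prod>k\<in>{..n} - {j}. sgn (x j - x k))"
    by (rule sgn_prod)
  also have "\<dots> = (\<Prod>k\<in>{..n} - {j}. if j < k then - 1 else 1)"
  proof (rule prod.cong)
    fix k assume k: "k \<in> {..n} - {j}"
    then show "sgn (x j - x k) = (if j < k then - 1 else 1)"
      using strict_mono_onD[OF assms(1), of j k] strict_mono_onD[OF assms(1), of k j] assms(2)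
      by auto
  qed simp
  also have "\<dots> = (\<Prod>k\<in>{j<..n}. - 1)"
    by (rule prod.mono_neutral_cong_right) auto
  finally show ?thesis by simp
qed

lemma full_bary_weight_altdef:
  "full_bary_weight n x j = inverse (\<Prod>k\<in>{..n} - {j}. x j - x k)"
  unfolding full_bary_weight_def by (simp add: o_def flip: prod_inversef)

lemma sgn_full_bary_weight_strict_mono:
  assumes "strict_mono_on {..n} x" "j \<le> n"
  shows "sgn (full_bary_weight n x j) = (- 1) ^ (n - j)"
  using sgn_prod_diff_strict_mono[OF assms] by (simp add: full_bary_weight_altdef flip: power_inverse)

text \<open>Reflecting the nodes at \<open>0\<close> makes them increasing and flips the sign of
  each of the \<open>n\<close> factors.\<close>

lemma sgn_full_bary_weight_strict_antimono:
  assumes "strict_antimono_on {..n} x" "j \<le> n"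
  shows "sgn (full_bary_weight n x j) = (- 1) ^ j"
proof -
  have "strict_mono_on {..n} (\<lambda>k. - x k)"
    using assms(1) by (auto simp: monotone_on_def)
  then have "sgn (full_bary_weight n (\<lambda>k. - x k) j) = (- 1) ^ (n - j)"
    using assms(2) by (rule sgn_full_bary_weight_strict_mono)
  moreover have "full_bary_weight n (\<lambda>k. - x k) j = (- 1) ^ n * full_bary_weight n x j"
  proof -
    have "full_bary_weight n (\<lambda>k. - x k) j = (\<Prod>k\<in>{..n} - {j}. - 1 * inverse (x j - x k))"
      unfolding full_bary_weight_def
      by (intro prod.cong) (simp_all flip: inverse_minus_eq)
    then show ?thesis
      using assms(2) unfolding full_bary_weight_def by (simp only: prod.distrib) simp
  qed
  ultimately have "(- 1) ^ n * sgn (full_bary_weight n x j) = (- 1) ^ (n - j)"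
    by (simp add: sgn_mult minus_one_power_iff split: if_splits)
  then have "sgn (full_bary_weight n x j) = (- 1) ^ n * (- 1) ^ (n - j)"
    by (metis minus_one_mult_self mult.assoc mult_1)
  then show ?thesis
    using assms(2) by (auto simp: minus_one_power_iff)
qed

section \<open>Squares of the barycentric weights\<close>

lemma node_weight_eq_full_bary_weight_square:
  assumes a: "\<alpha> > - 1"
    and L: "laguerre_polys \<alpha> L"
    and roots: "x ` {..n} = {t. poly (L (n + 1)) t = 0}"
    and inj: "inj_on x {..n}"
    and quad: "gauss_laguerre_weights \<alpha> n x w"
    and j: "j \<le> n"
  shows "x j * w j = Gamma (real n + \<alpha> + 2) * fact (n + 1) * (full_bary_weight n x j)\<^sup>2"
proof -
  define N where "N = n + 1"
  define P where "P = (\<Prod>k\<in>{..n}. [:- x k, 1:])"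
  define q where "q = (\<Prod>k\<in>{..n} - {j}. [:- x k, 1:])"
  define c where "c = (- 1) ^ N / (fact N :: real)"
  have c: "c \<noteq> 0"
    by (simp add: c_def)
  have Pq: "P = [:- x j, 1:] * q"
    unfolding P_def q_def using j by (simp add: prod.remove[of _ j])
  have degP: "degree P = N"
    unfolding P_def N_def by (subst degree_prod_sum_eq) auto
  have degq: "degree q = n"
    unfolding q_def using j by (subst degree_prod_sum_eq) auto
  have "lead_coeff P = 1" and leadq: "lead_coeff q = 1"
    unfolding P_def q_def by (simp_all add: lead_coeff_prod)
  then have coP: "coeff P N = 1"
    using degP by simp
  \<comment> \<open>Both sides have the same coefficient at \<open>N\<close> and agree at the
    \<open>N\<close> distinct nodes.\<close>
  have LP: "L N = smult c P"
  proof (rule poly_eqI_degree_lead_coeff)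
    show "coeff (L N) N = coeff (smult c P) N"
      using L coP unfolding laguerre_polys_def c_def by (metis coeff_smult mult.right_neutral)
    show "card (x ` {..n}) \<ge> N"
      using inj by (simp add: card_image N_def)
    show "degree (L N) \<le> N"
      using L unfolding laguerre_polys_def by simp
    show "degree (smult c P) \<le> N"
      using degP by simp
    show "poly (L N) z = poly (smult c P) z" if "z \<in> x ` {..n}" for z
      using that roots by (auto simp: N_def P_def poly_prod)
  qed
  have orth: "laguerre_functional \<alpha> (P * r) = 0" if "\<And>i. i \<ge> N \<Longrightarrow> coeff r i = 0" for r
    using laguerre_polys_orthogonal[OF a L order_refl, of N r] that c
    by (simp add: LP laguerre_functional_smult)
  have xq: "degree (pCons 0 q) \<le> N" "coeff (pCons 0 q) N = 1"
    using degq leadq by (auto simp: N_def degree_pCons_le intro: order_trans[OF degree_pCons_le])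
  have "laguerre_functional \<alpha> (P * pCons 0 q) = fact N * Gamma (\<alpha> + real N + 1)"
    using a _ coP xq orth by (rule laguerre_functional_monic_orthogonal) (simp add: degP)
  moreover have "laguerre_functional \<alpha> (pCons 0 (q * q)) = laguerre_functional \<alpha> (P * pCons 0 q)"
  proof -
    \<comment> \<open>\<open>P * r\<close> collects the terms of
      \<open>x (P q)' + (\<alpha> + 1 - x) P q\<close> other than \<open>x q^2\<close> and
      \<open>- x P q\<close>; \<open>r\<close> has degree at most \<open>n\<close>, so orthogonality
      removes it.\<close>
    define r where "r = pCons 0 (smult 2 (pderiv q)) + smult (\<alpha> + 1) q"
    have "laguerre_functional \<alpha> (P * r) = 0"
      using degq by (intro orth)
        (auto simp: r_def N_def coeff_pCons coeff_pderiv coeff_eq_0 split: nat.splits)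
    moreover have "pCons 0 (q * q) =
        ([:0, 1:] * pderiv (P * q) + [:\<alpha> + 1, -1:] * (P * q)) + P * pCons 0 q - P * r"
    proof -
      \<comment> \<open>From \<open>P = (x - x_j) q\<close> follows
        \<open>P' q = q^2 + P q'\<close>.\<close>
      have "pderiv (P * q) = q * q + P * smult 2 (pderiv q)"
        unfolding Pq pderiv_mult
        by (rule poly_eq_poly_eq_iff[THEN iffD1]) (simp add: fun_eq_iff pderiv_pCons algebra_simps)
      then show ?thesis
        by (simp add: r_def algebra_simps)
    qed
    ultimately show ?thesis
      using laguerre_functional_by_parts[OF a, of "P * q"]
      by (simp only: laguerre_functional_add[OF a] laguerre_functional_diff[OF a])
  qed
  moreover have "laguerre_functional \<alpha> (pCons 0 (q * q)) = x j * w j * (poly q (x j))\<^sup>2"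
  proof -
    have "degree (pCons 0 (q * q)) \<le> 2 * n + 1"
      using degq degree_mult_le[of q q] by (intro order_trans[OF degree_pCons_le]) simp
    then have "laguerre_functional \<alpha> (pCons 0 (q * q)) =
        (\<Sum>k\<le>n. w k * poly (pCons 0 (q * q)) (x k))"
      using quad unfolding gauss_laguerre_weights_def by (intro laguerre_integral_unique) blast
    also have "\<dots> = (\<Sum>k\<in>{j}. w k * poly (pCons 0 (q * q)) (x k))"
      using j by (intro sum.mono_neutral_right) (auto simp: q_def poly_prod)
    finally show ?thesis
      by (simp add: power2_eq_square)
  qed
  moreover have "poly q (x j) = (\<Prod>k\<in>{..n} - {j}. x j - x k)"
    by (simp add: q_def poly_prod)
  moreover have "poly q (x j) \<noteq> 0"
    using inj j by (auto simp: q_def poly_prod inj_on_def)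
  ultimately show ?thesis
    by (simp add: full_bary_weight_altdef N_def field_simps)
qed

text \<open>For decreasing nodes the full weights have sign \<open>(-1)^j\<close>, so the factor
  \<open>(-1)^n\<close> is tied to increasing order; simplified weights absorb either sign into the
  common factor.\<close>

theorem corollary4:
  fixes \<alpha> :: real and n :: nat
    and L :: "nat \<Rightarrow> real poly" and x w :: "nat \<Rightarrow> real"
  assumes "\<alpha> > - 1"
    and "laguerre_polys \<alpha> L"
    and "x ` {..n} = {t. poly (L (n + 1)) t = 0}"
    and "strict_mono_on {..n} x \<or> strict_antimono_on {..n} x"
    and "gauss_laguerre_weights \<alpha> n x w"
  shows "simplified_bary_weights n x (\<lambda>j. (- 1) ^ j * sqrt (x j * w j)) \<and>
    (strict_mono_on {..n} x \<longrightarrow>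
      (\<forall>j\<le>n. full_bary_weight n x j =
        (if even n then 1 else - 1) * (1 / sqrt (Gamma (real n + \<alpha> + 2) * fact (n + 1)))
          * (- 1) ^ j * sqrt (x j * w j)))"
proof -
  define h where "h = Gamma (real n + \<alpha> + 2) * fact (n + 1)"
  have "h > 0"
    unfolding h_def using assms(1) by (intro mult_pos_pos Gamma_real_pos) auto
  have "inj_on x {..n}"
    using assms(4) unfolding inj_on_def monotone_on_def by (metis less_irrefl linorder_neqE_nat)
  then have "x j * w j = h * (full_bary_weight n x j)\<^sup>2" if "j \<le> n" for j
    using node_weight_eq_full_bary_weight_square assms that unfolding h_def by blast
  then have "sqrt (x j * w j) = sqrt h * \<bar>full_bary_weight n x j\<bar>" if "j \<le> n" for j
    using that by (simp add: real_sqrt_mult)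
  \<comment> \<open>The square root yields only the absolute value of the weight; \<open>sgn\<close>
    restores the sign.\<close>
  then have full: "full_bary_weight n x j =
      1 / sqrt h * sgn (full_bary_weight n x j) * sqrt (x j * w j)" if "j \<le> n" for j
    using that \<open>h > 0\<close> by (simp add: sgn_mult_abs field_simps) (metis abs_mult_sgn mult.commute)
  \<comment> \<open>Here \<open>(-1)^(n - j) = (-1)^n (-1)^j\<close>, and \<open>(-1)^n\<close> is
    the conditional factor.\<close>
  have mono: "full_bary_weight n x j =
      (if even n then 1 else - 1) * (1 / sqrt h) * (- 1) ^ j * sqrt (x j * w j)"
    if "strict_mono_on {..n} x" "j \<le> n" for j
    using full[OF that(2)] sgn_full_bary_weight_strict_mono[OF that] that(2)
    by (auto simp: minus_one_power_iff)
  have anti: "full_bary_weight n x j = 1 / sqrt h * ((- 1) ^ j * sqrt (x j * w j))"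
    if "strict_antimono_on {..n} x" "j \<le> n" for j
    using full[OF that(2)] sgn_full_bary_weight_strict_antimono[OF that] by simp
  have "simplified_bary_weights n x (\<lambda>j. (- 1) ^ j * sqrt (x j * w j))"
    using assms(4)
  proof
    assume "strict_mono_on {..n} x"
    then show ?thesis
      using mono \<open>h > 0\<close> unfolding simplified_bary_weights_def
      by (intro exI[of _ "(if even n then 1 else - 1) * (1 / sqrt h)"])
        (simp add: mult.assoc)
  next
    assume "strict_antimono_on {..n} x"
    then show ?thesis
      using anti \<open>h > 0\<close> unfolding simplified_bary_weights_def
      by (intro exI[of _ "1 / sqrt h"]) simp
  qed
  then show ?thesis
    using mono unfolding h_def by blast
qed

end
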